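(* Let $\theta:(0,\infty)\to(0,\infty)$, $u_0:(0,\infty)\to\mathbb{R}$ and $f:[0,\infty)\times\mathbb{R}\times(0,\infty)\to\overline{\mathbb{R}}$ be such that for each $\lambda>0$, $\lim_{t\to\theta(\lambda),\,t<\theta(\lambda)}f(t,x,\lambda)=\pm\infty$ for almost all $x\in\mathbb{R}$. Assume the following. (i) For each $\lambda>0$ and $0<\varepsilon<\theta(\lambda)$ there is a constant $L(\lambda,\varepsilon)$ such that $|f(t,x,\lambda)-f(t,\overline{x},\lambda)|\le L(\lambda,\varepsilon)|x-\overline{x}|$ for all $x,\overline{x}\in\mathbb{R}$ and all $t\in[0,\theta(\lambda)-\varepsilon]$. (ii) The maps $\lambda\mapsto\theta(\lambda)$, $\lambda\mapsto u_0(\lambda)$ and, for each $\varepsilon>0$, $\lambda\mapsto L(\lambda,\varepsilon)$ are continuous, and $(t,x,\lambda)\mapsto f(t,x,\lambda)$ is continuous for $t\in[0,\theta(\lambda))$, $x\in\mathbb{R}$, $\lambda\in(0,\infty)$. (iii) There is a constant $a>1$ such that for all $\lambda>0$, $|f(t,x,\lambda)|\le\frac{|x|}{a(\theta(\lambda)-t)}+C_\lambda$ for all $t\in[0,\theta(\lambda))$ and all $x\in\mathbb{R}$, where $C_\lambda\ge 0$ and $\lambda\mapsto C_\lambda$ is continuous. For $\lambda>0$ let $u_\lambda\in C[0,\theta(\lambda))$ be the unique solution of $u'(t)=f(t,u(t),\lambda)$, $t\in[0,\theta(\lambda))$, $u(0)=u_0(\lambda)$, and let $\varphi(\lambda)=\int_0^{\theta(\lambda)}u_\lambda(s)\,ds$.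 Let $p\in\mathbb{R}$ and suppose there exist $\underline{\lambda},\overline{\lambda}>0$ with $$\varphi(\underline{\lambda})<p\quad\text{and}\quad\varphi(\overline{\lambda})>p.$$ Then there is $\lambda^*$ lying between $\underline{\lambda}$ and $\overline{\lambda}$ such that $$\int_0^{\theta(\lambda^* )}u_{\lambda^*}(s)\,ds=p.$$
   Context: $\overline{\mathbb{R}}=\mathbb{R}\cup\{\pm\infty\}$; $f$ is real-valued for $t\in[0,\theta(\lambda))$. The map $\lambda\mapsto L(\lambda,\varepsilon)$ is considered for those $\lambda$ with $\theta(\lambda)>\varepsilon$. Under (i) and (ii) the initial value problem has, for each $\lambda>0$, a unique solution $u_\lambda\in C[0,\theta(\lambda))$, and under (i)-(iii) the integral defining $\varphi(\lambda)$ converges. Integrals over $[0,\theta(\lambda))$ are improper: $\int_0^{\theta(\lambda)}u(s)\,ds=\lim_{t\to\theta(\lambda),\,t<\theta(\lambda)}\int_0^t u(s)\,ds$. No order between $\underline{\lambda}$ and $\overline{\lambda}$ is assumed. *)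

theory Defs
  imports "HOL-Analysis.Analysis"
begin

text \<open>
  Functions in \<open>C[0,b)\<close> are total functions that are undefined outside \<open>[0,b)\<close>
  (\<^const>\<open>extensional\<close>), so that uniqueness of a solution is equality in HOL.
  The right-hand side \<open>g\<close> is extended-real-valued; \<^const>\<open>real_of_ereal\<close> is harmless
  where \<open>g\<close> is finite. At \<open>0\<close> the derivative is one-sided.
\<close>

definition ivp_solution ::
  "(real \<Rightarrow> real \<Rightarrow> ereal) \<Rightarrow> real \<Rightarrow> real \<Rightarrow> (real \<Rightarrow> real) \<Rightarrow> bool" where
  "ivp_solution g b c u \<longleftrightarrow>
     u \<in> extensional {0..<b} \<and>
     continuous_on {0..<b} u \<and>
     u 0 = c \<and>
     (\<forall>t\<in>{0..<b}. (u has_real_derivative real_of_ereal (g t (u t))) (at t within {0..<b}))"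

definition the_ivp_solution ::
  "(real \<Rightarrow> real \<Rightarrow> ereal) \<Rightarrow> real \<Rightarrow> real \<Rightarrow> real \<Rightarrow> real" where
  "the_ivp_solution g b c = (THE u. ivp_solution g b c u)"

definition has_improper_integral :: "(real \<Rightarrow> real) \<Rightarrow> real \<Rightarrow> real \<Rightarrow> bool" where
  "has_improper_integral u b I \<longleftrightarrow>
     (\<forall>t\<in>{0..<b}. u integrable_on {0..t}) \<and>
     ((\<lambda>t. integral {0..t} u) \<longlongrightarrow> I) (at_left b)"

definition improper_integral :: "(real \<Rightarrow> real) \<Rightarrow> real \<Rightarrow> real" where
  "improper_integral u b = (THE I. has_improper_integral u b I)"

end

theory Submission
  imports Defs
begin

text \<open>
  The map \<open>\<lambda> \<mapsto> \<phi>(\<lambda>)\<close> is continuous on \<open>(0,\<infinity>)\<close>, so it takes the value \<open>p\<close> between \<open>lo\<close> and \<open>hi\<close> by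
  the intermediate value theorem. Continuity has two ingredients.

  First, the solution \<open>u\<^sub>\<lambda>(t)\<close> is jointly continuous in \<open>(t,\<lambda>)\<close> on the region
  \<open>{(t,\<lambda>). \<lambda> > 0, 0 \<le> t < \<theta>(\<lambda>)}\<close>. The Picard iterates are jointly continuous there, and the usual
  factorial estimate (\<open>picard_step_bound\<close>) involves only \<open>L(\<lambda>,\<epsilon>)\<close>, \<open>u\<^sub>0(\<lambda>)\<close>, \<open>C\<^sub>\<lambda>\<close> and
  \<open>\<theta>(\<lambda>)\<close>, which are bounded for \<open>\<lambda>\<close> in a compact interval. Hence the iterates converge uniformly
  on the sets \<open>{(t,\<lambda>). \<lambda> \<in> [l1,l2], 0 \<le> t \<le> \<theta>(\<lambda>) - \<epsilon>}\<close> (\<open>picard_uniform_limit\<close>), whose relative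
  interiors cover the region. The limit is therefore continuous, and it solves the integral
  equation. Existence and continuous dependence thus come out of the same argument; uniqueness is
  Gronwall's inequality for the squared difference of two solutions.

  Second, the improper integral converges locally uniformly in \<open>\<lambda>\<close>. The growth condition gives
  \<open>|u\<^sub>\<lambda>(t)| \<le> M(\<lambda>) (\<theta>(\<lambda>) - t)\<^bsup>-1/a\<^esup>\<close> with \<open>M\<close> continuous (\<open>sol_bound\<close>). As \<open>1/a < 1\<close>, this
  majorant is integrable, so the integral over \<open>[t,\<theta>(\<lambda>))\<close> is
  in absolute value at most \<open>M(\<lambda>) (\<theta>(\<lambda>) - t)\<^bsup>1-1/a\<^esup> / (1 - 1/a)\<close> (\<open>integral_sol_tail\<close>). Consequently \<open>\<phi>\<close> is a locally
  uniform limit of the continuous functions \<open>\<lambda> \<mapsto> \<integral>\<^sub>0\<^bsup>\<theta>(\<lambda>)(1-1/(n+1))\<^esup> u\<^sub>\<lambda>\<close>.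
\<close>

section \<open>Limits, integrals and intermediate values\<close>

lemma continuous_on_interval_abs_bound:
  fixes h :: "real \<Rightarrow> real"
  assumes "continuous_on {x..y} h"
  shows "\<exists>K\<ge>0. \<forall>l\<in>{x..y}. \<bar>h l\<bar> \<le> K"
proof -
  have "bounded (h ` {x..y})"
    using assms by (intro compact_imp_bounded compact_continuous_image) auto
  then obtain K where "K > 0" "\<forall>z\<in>h ` {x..y}. norm z \<le> K" unfolding bounded_pos by blast
  then show ?thesis by (intro exI[of _ K]) auto
qed

lemma integral_eq_scaled_unit_interval:
  fixes h :: "real \<Rightarrow> real"
  assumes "0 \<le> t" "continuous_on {0..t} h"
  shows "integral {0..t} h = integral {0..1} (\<lambda>r. t * h (t * r))"
proof -
  have "((\<lambda>r. t *\<^sub>R h (t * r)) has_integral integral {t * 0..t * 1} h) {0..1}"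
    using assms
    by (intro has_integral_substitution[where c = 0 and d = t])
       (auto intro!: derivative_eq_intros mult_left_le mult_nonneg_nonneg simp: mult_left_le)
  then show ?thesis by (simp add: integral_unique del: integral_mult_right)
qed

lemma has_integral_power_over_fact:
  fixes t :: real
  assumes "0 \<le> t"
  shows "((\<lambda>s. s ^ m / fact m) has_integral t ^ Suc m / fact (Suc m)) {0..t}"
proof -
  have deriv: "((\<lambda>s. s ^ Suc m / fact (Suc m)) has_real_derivative s ^ m / fact m) (at s within {0..t})"
    for s :: real
  proof -
    have "((\<lambda>s. s ^ Suc m / fact (Suc m)) has_real_derivative
        (real (Suc m) * s ^ m) / (real (Suc m) * fact m)) (at s within {0..t})"
      unfolding fact_Suc using DERIV_pow[of "Suc m" s "{0..t}"] by (intro DERIV_cdivide) simp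
    moreover have "(real (Suc m) * s ^ m) / (real (Suc m) * fact m) = s ^ m / fact m"
      by (rule mult_divide_mult_cancel_left) simp
    ultimately show ?thesis by simp
  qed
  have "((\<lambda>s. s ^ m / fact m) has_integral
      t ^ Suc m / fact (Suc m) - 0 ^ Suc m / fact (Suc m)) {0..t}"
    using assms deriv
    by (intro fundamental_theorem_of_calculus)
       (auto simp: has_real_derivative_iff_has_vector_derivative[symmetric])
  then show ?thesis by simp
qed

lemma continuous_on_slice:
  assumes "continuous_on D (\<lambda>(t, l). h t l)" "\<And>t. t \<in> T \<Longrightarrow> (t, l) \<in> D"
  shows "continuous_on T (\<lambda>t. h t l)"
proof -
  have "continuous_on T ((\<lambda>(t, l). h t l) \<circ> (\<lambda>t. (t, l)))"
    using assms(2)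
    by (intro continuous_on_compose continuous_on_subset[OF assms(1)] continuous_intros) auto
  then show ?thesis by (simp add: o_def)
qed

text \<open>
  Rescaling to \<open>[0,1]\<close> turns the variable upper limit of integration into a parameter of the
  integrand.
\<close>

lemma continuous_on_primitive_param:
  fixes h :: "real \<Rightarrow> real \<Rightarrow> real"
  assumes cont: "continuous_on D (\<lambda>(t, l). h t l)"
    and nonneg: "\<And>t l. (t, l) \<in> D \<Longrightarrow> 0 \<le> t"
    and down: "\<And>s t l. (t, l) \<in> D \<Longrightarrow> 0 \<le> s \<Longrightarrow> s \<le> t \<Longrightarrow> (s, l) \<in> D"
  shows "continuous_on D (\<lambda>(t, l). integral {0..t} (\<lambda>s. h s l))"
proof -
  have "continuous_on (D \<times> cbox 0 1) (\<lambda>x. (\<lambda>(t, l). h t l) (fst (fst x) * snd x, snd (fst x)))"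
  proof (rule continuous_on_compose2[OF cont])
    show "(\<lambda>x. (fst (fst x) * snd x, snd (fst x))) ` (D \<times> cbox 0 1) \<subseteq> D"
    proof clarsimp
      fix t l r :: real assume tl: "(t, l) \<in> D" and r: "0 \<le> r" "r \<le> 1"
      have "0 \<le> t * r" "t * r \<le> t" using nonneg[OF tl] r by (auto intro: mult_left_le)
      then show "(t * r, l) \<in> D" by (rule down[OF tl])
    qed
  qed (intro continuous_intros)
  then have "continuous_on (D \<times> cbox 0 1) (\<lambda>x. fst (fst x) * h (fst (fst x) * snd x) (snd (fst x)))"
    by (intro continuous_on_mult) (auto intro!: continuous_intros)
  then have "continuous_on D (\<lambda>x. integral (cbox 0 1) (\<lambda>r. fst x * h (fst x * r) (snd x)))"
    by (intro integral_continuous_on_param) (simp add: case_prod_beta)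
  moreover have "integral {0..t} (\<lambda>s. h s l) = integral (cbox 0 1) (\<lambda>r. t * h (t * r) l)"
    if "(t, l) \<in> D" for t l
    using integral_eq_scaled_unit_interval[of t "\<lambda>s. h s l"] nonneg[OF that]
      continuous_on_slice[OF cont, of "{0..t}" l] down[OF that] by auto
  ultimately show ?thesis
    by (subst continuous_on_cong[OF refl]) (auto simp: case_prod_beta)
qed

lemma DERIV_powr_distance:
  fixes b T t :: real
  assumes "t < T"
  shows "((\<lambda>s. (T - s) powr b) has_real_derivative - b * (T - t) powr (b - 1)) (at t)"
proof -
  have "((\<lambda>s. T - s) has_real_derivative -1) (at t)" by (auto intro!: derivative_eq_intros)
  then show ?thesis using DERIV_fun_powr[of "\<lambda>s. T - s" "-1" t b] assms by simp
qed

text \<open>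
  A Cauchy criterion with an explicit modulus \<open>h\<close>, which also bounds the distance to the limit.
\<close>

lemma tail_bound_imp_limit_at_left:
  fixes G h :: "real \<Rightarrow> real"
  assumes "0 < b"
    and tail: "\<And>s t. 0 \<le> s \<Longrightarrow> s \<le> t \<Longrightarrow> t < b \<Longrightarrow> \<bar>G t - G s\<bar> \<le> h s"
    and h: "(h \<longlongrightarrow> 0) (at_left b)"
  obtains I where "(G \<longlongrightarrow> I) (at_left b)" "\<And>s. 0 \<le> s \<Longrightarrow> s < b \<Longrightarrow> \<bar>I - G s\<bar> \<le> h s"
proof -
  define x where "x n = b - b * inverse (real (Suc n))" for n
  have x_range: "0 \<le> x n" "x n < b" for n
    using assms(1) by (auto simp: x_def field_simps)
  have x_mono: "x m \<le> x n" if "m \<le> n" for m n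
    using that assms(1) unfolding x_def by (intro diff_left_mono mult_left_mono le_imp_inverse_le) auto
  have "x \<longlonglongrightarrow> b - b * 0"
    unfolding x_def by (intro tendsto_intros LIMSEQ_inverse_real_of_nat)
  then have x_lim: "filterlim x (at_left b) sequentially"
    using x_range by (auto simp: filterlim_at intro!: always_eventually)
  have hx: "(\<lambda>n. h (x n)) \<longlonglongrightarrow> 0" by (rule filterlim_compose[OF h x_lim])
  have "Cauchy (\<lambda>n. G (x n))"
  proof (rule CauchyI')
    fix e :: real assume "e > 0"
    then obtain M where "\<And>m. m \<ge> M \<Longrightarrow> \<bar>h (x m)\<bar> < e" using LIMSEQ_D[OF hx] by force
    then have "dist (G (x m)) (G (x n)) < e" if "m \<ge> M" "n > m" for m n
      using tail[of "x m" "x n"] x_range x_mono[of m n] that by (force simp: dist_real_def abs_minus_commute)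
    then show "\<exists>M. \<forall>m\<ge>M. \<forall>n>m. dist (G (x m)) (G (x n)) < e" by blast
  qed
  then obtain I where I: "(\<lambda>n. G (x n)) \<longlonglongrightarrow> I" by (auto simp: Cauchy_convergent_iff convergent_def)
  have bound: "\<bar>I - G s\<bar> \<le> h s" if s: "0 \<le> s" "s < b" for s
  proof (rule tendsto_upperbound)
    show "(\<lambda>n. \<bar>G (x n) - G s\<bar>) \<longlonglongrightarrow> \<bar>I - G s\<bar>" using I by (intro tendsto_intros)
    have "\<forall>\<^sub>F n in sequentially. s < x n"
      using \<open>x \<longlonglongrightarrow> b - b * 0\<close> s by (intro order_tendstoD(1)) auto
    then show "\<forall>\<^sub>F n in sequentially. \<bar>G (x n) - G s\<bar> \<le> h s"
      by eventually_elim (use s x_range in \<open>auto intro: tail\<close>)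
  qed simp
  have "((\<lambda>s. G s - I) \<longlongrightarrow> 0) (at_left b)"
  proof (rule Lim_null_comparison[OF _ h])
    show "\<forall>\<^sub>F s in at_left b. norm (G s - I) \<le> h s"
      using eventually_at_left_real[OF assms(1)]
      by eventually_elim (use bound in \<open>auto simp: abs_minus_commute\<close>)
  qed
  then have "(G \<longlongrightarrow> I) (at_left b)" by (simp add: LIM_zero_iff)
  then show ?thesis using that bound by blast
qed

lemma improper_integral_eq:
  assumes "has_improper_integral w b I"
  shows "improper_integral w b = I"
  unfolding improper_integral_def
proof (rule the_equality)
  show "has_improper_integral w b I" by fact
  fix J assume "has_improper_integral w b J"
  with assms show "J = I"
    unfolding has_improper_integral_def by (auto intro: tendsto_unique[rotated])
qed

lemma IVT_strict_between:
  fixes h :: "real \<Rightarrow> real"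
  assumes "continuous_on {min x y..max x y} h" "h x < p" "p < h y"
  obtains z where "z \<in> {min x y<..<max x y}" "h z = p"
proof -
  have "\<exists>z\<in>{min x y..max x y}. h z = p"
  proof (cases "x \<le> y")
    case True
    then show ?thesis using IVT'[of h x p y] assms by auto
  next
    case False
    then show ?thesis using IVT2'[of h x p y] assms by auto
  qed
  then obtain z where "z \<in> {min x y..max x y}" "h z = p" by blast
  moreover from this have "z \<noteq> x" "z \<noteq> y" using assms by auto
  ultimately show ?thesis by (intro that[of z]) (auto simp: min_def max_def split: if_splits)
qed

section \<open>A family of initial value problems\<close>

text \<open>
  The hypotheses on the data, for a real-valued right-hand side \<open>g\<close>; the parameter \<open>\<lambda>\<close> is written
  \<open>l\<close>, as the last argument of \<open>g\<close> and the first one of \<open>L\<close>.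
\<close>

locale ivp_family =
  fixes \<theta> u\<^sub>0 C :: "real \<Rightarrow> real" and g :: "real \<Rightarrow> real \<Rightarrow> real \<Rightarrow> real"
    and L :: "real \<Rightarrow> real \<Rightarrow> real" and a :: real
  assumes theta_pos: "\<And>l. l > 0 \<Longrightarrow> \<theta> l > 0"
    and lipschitz: "\<And>l e t x y. l > 0 \<Longrightarrow> 0 < e \<Longrightarrow> e < \<theta> l \<Longrightarrow> t \<in> {0..\<theta> l - e} \<Longrightarrow>
      \<bar>g t x l - g t y l\<bar> \<le> L l e * \<bar>x - y\<bar>"
    and theta_cont: "continuous_on {0<..} \<theta>"
    and u0_cont: "continuous_on {0<..} u\<^sub>0"
    and L_cont: "\<And>e. e > 0 \<Longrightarrow> continuous_on {l. l > 0 \<and> \<theta> l > e} (\<lambda>l. L l e)"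
    and g_cont: "continuous_on {(t, x, l). l > 0 \<and> t \<in> {0..<\<theta> l}} (\<lambda>(t, x, l). g t x l)"
    and a_gt_1: "a > 1"
    and growth: "\<And>l t x. l > 0 \<Longrightarrow> t \<in> {0..<\<theta> l} \<Longrightarrow>
      \<bar>g t x l\<bar> \<le> \<bar>x\<bar> / (a * (\<theta> l - t)) + C l"
    and C_nonneg: "\<And>l. l > 0 \<Longrightarrow> C l \<ge> 0"
    and C_cont: "continuous_on {0<..} C"
begin

text \<open>The pairs of a time and a parameter at which the solutions are defined.\<close>

definition region :: "(real \<times> real) set" where
  "region = {(t, l). l > 0 \<and> 0 \<le> t \<and> t < \<theta> l}"

lemma continuous_on_region_imp_slice:
  assumes "continuous_on region (\<lambda>(t, l). h t l)" "l > 0"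
  shows "continuous_on {0..<\<theta> l} (\<lambda>t. h t l)"
  by (rule continuous_on_slice[OF assms(1)]) (use assms(2) in \<open>auto simp: region_def\<close>)

lemma continuous_on_region_primitive:
  fixes h :: "real \<Rightarrow> real \<Rightarrow> real"
  assumes "continuous_on region (\<lambda>(t, l). h t l)"
  shows "continuous_on region (\<lambda>(t, l). integral {0..t} (\<lambda>s. h s l))"
  by (rule continuous_on_primitive_param[OF assms]) (auto simp: region_def)

lemma continuous_on_rhs:
  assumes "continuous_on D (\<lambda>x. h x)" "continuous_on D T" "continuous_on D l"
    and "\<And>x. x \<in> D \<Longrightarrow> (T x, l x) \<in> region"
  shows "continuous_on D (\<lambda>x. g (T x) (h x) (l x))"
proof -
  have "continuous_on D (\<lambda>x. (\<lambda>(t, x, l). g t x l) (T x, h x, l x))"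
    by (rule continuous_on_compose2[OF g_cont])
       (use assms in \<open>auto intro!: continuous_intros simp: region_def\<close>)
  then show ?thesis by simp
qed

lemma continuous_on_rhs_region:
  assumes "continuous_on region (\<lambda>(t, l). h t l)"
  shows "continuous_on region (\<lambda>(t, l). g t (h t l) l)"
proof -
  have "continuous_on region (\<lambda>x. g (fst x) (h (fst x) (snd x)) (snd x))"
    using assms by (intro continuous_on_rhs) (auto intro!: continuous_intros simp: case_prod_beta)
  then show ?thesis by (simp add: case_prod_beta)
qed

lemma lipschitz_nonneg:
  assumes "l > 0" "0 < e" "e < \<theta> l"
  shows "L l e \<ge> 0"
  using lipschitz[OF assms, of 0 1 0] assms by auto

section \<open>Picard iteration with a parameter\<close>

text \<open>
  The argument order \<open>picard n t l\<close> is index, time, parameter.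
\<close>

primrec picard :: "nat \<Rightarrow> real \<Rightarrow> real \<Rightarrow> real" where
  "picard 0 = (\<lambda>t l. u\<^sub>0 l)"
| "picard (Suc n) = (\<lambda>t l. u\<^sub>0 l + integral {0..t} (\<lambda>s. g s (picard n s l) l))"

lemma continuous_on_u0_region: "continuous_on region (\<lambda>(t, l). u\<^sub>0 l)"
proof -
  have "continuous_on region (\<lambda>x. u\<^sub>0 (snd x))"
    by (rule continuous_on_compose2[OF u0_cont]) (auto intro!: continuous_intros simp: region_def)
  then show ?thesis by (simp add: case_prod_beta)
qed

lemma continuous_on_picard: "continuous_on region (\<lambda>(t, l). picard n t l)"
proof (induction n)
  case 0
  then show ?case using continuous_on_u0_region by simp
next
  case (Suc n)
  have "continuous_on region (\<lambda>x. (\<lambda>(t, l). u\<^sub>0 l) x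
      + (\<lambda>(t, l). integral {0..t} (\<lambda>s. g s (picard n s l) l)) x)"
    using Suc
    by (intro continuous_on_add continuous_on_u0_region continuous_on_region_primitive
        continuous_on_rhs_region)
  then show ?case by (simp add: case_prod_beta)
qed

lemma rhs_integrable:
  assumes "continuous_on region (\<lambda>(t, l). h t l)" "l > 0" "t < \<theta> l"
  shows "(\<lambda>s. g s (h s l) l) integrable_on {0..t}"
  using continuous_on_region_imp_slice[OF continuous_on_rhs_region[OF assms(1)] assms(2)] assms(3)
  by (intro integrable_continuous_interval) (auto elim: continuous_on_subset)

text \<open>
  For \<open>s \<le> \<theta> l - e\<close> the growth condition gives \<open>|g s (u\<^sub>0 l) l| \<le> |u\<^sub>0 l| / (a e) + C l\<close>, which bounds
  the first step; each further step gains the factor \<open>L l e\<close> and one integration in time.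
\<close>

lemma picard_step_bound:
  assumes "l > 0" "0 < e" "e < \<theta> l" "t \<in> {0..\<theta> l - e}"
  shows "\<bar>picard (Suc n) t l - picard n t l\<bar>
           \<le> (\<bar>u\<^sub>0 l\<bar> / (a * e) + C l) * L l e ^ n * (t ^ Suc n / fact (Suc n))"
  using assms(4)
proof (induction n arbitrary: t)
  case 0
  let ?B = "\<bar>u\<^sub>0 l\<bar> / (a * e) + C l"
  have *: "norm (g s (u\<^sub>0 l) l) \<le> ?B" if "s \<in> {0..t}" for s
  proof -
    have "\<bar>g s (u\<^sub>0 l) l\<bar> \<le> \<bar>u\<^sub>0 l\<bar> / (a * (\<theta> l - s)) + C l"
      using that 0 assms by (intro growth) auto
    also have "\<dots> \<le> ?B"
      using that 0 assms a_gt_1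
      by (intro add_mono divide_left_mono mult_left_mono mult_pos_pos) auto
    finally show ?thesis by simp
  qed
  have "norm (integral {0..t} (\<lambda>s. g s (u\<^sub>0 l) l)) \<le> integral {0..t} (\<lambda>s. ?B)"
    using rhs_integrable[OF continuous_on_u0_region, of l t] 0 assms *
    by (intro integral_norm_bound_integral) auto
  then show ?case using 0 by (simp add: mult.commute)
next
  case (Suc n)
  let ?B = "\<bar>u\<^sub>0 l\<bar> / (a * e) + C l" and ?p = "\<lambda>n s. g s (picard n s l) l"
  have int: "?p k integrable_on {0..t}" for k
    using Suc.prems assms by (intro rhs_integrable continuous_on_picard) auto
  have *: "norm (?p (Suc n) s - ?p n s) \<le> ?B * L l e ^ Suc n * (s ^ Suc n / fact (Suc n))"
    if "s \<in> {0..t}" for s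
  proof -
    have "norm (?p (Suc n) s - ?p n s) \<le> L l e * \<bar>picard (Suc n) s l - picard n s l\<bar>"
      using that Suc.prems assms unfolding real_norm_def by (intro lipschitz) auto
    also have "\<dots> \<le> L l e * (?B * L l e ^ n * (s ^ Suc n / fact (Suc n)))"
      using that Suc.prems lipschitz_nonneg[OF assms(1-3)]
      by (intro mult_left_mono Suc.IH) auto
    finally show ?thesis by (simp add: mult_ac)
  qed
  have prim: "((\<lambda>s. s ^ Suc n / fact (Suc n)) has_integral t ^ Suc (Suc n) / fact (Suc (Suc n))) {0..t}"
    using Suc.prems by (intro has_integral_power_over_fact) auto
  have prim': "((\<lambda>s. ?B * L l e ^ Suc n * (s ^ Suc n / fact (Suc n))) has_integral
      ?B * L l e ^ Suc n * (t ^ Suc (Suc n) / fact (Suc (Suc n)))) {0..t}"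
    using has_integral_mult_right[OF prim, of "?B * L l e ^ Suc n"] by simp
  have "picard (Suc (Suc n)) t l - picard (Suc n) t l
      = integral {0..t} (\<lambda>s. ?p (Suc n) s - ?p n s)"
    using integral_diff[OF int[of "Suc n"] int[of n]] by simp
  moreover have "norm (integral {0..t} (\<lambda>s. ?p (Suc n) s - ?p n s))
      \<le> integral {0..t} (\<lambda>s. ?B * L l e ^ Suc n * (s ^ Suc n / fact (Suc n)))"
    by (rule integral_norm_bound_integral)
       (use * integrable_diff[OF int[of "Suc n"] int[of n]] has_integral_integrable[OF prim'] in auto)
  ultimately show ?case using integral_unique[OF prim'] by simp
qed

text \<open>
  The limit of the Picard iterates at time \<open>t\<close> for the parameter \<open>l\<close>; it is meaningful only for
  \<open>(t, l)\<close> in \<^const>\<open>region\<close>.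
\<close>

definition sol :: "real \<Rightarrow> real \<Rightarrow> real" where
  "sol t l = lim (\<lambda>n. picard n t l)"

lemma picard_uniform_limit:
  assumes "0 < l1" "0 < e" "\<And>l. l \<in> {l1..l2} \<Longrightarrow> e < \<theta> l"
  shows "uniform_limit {(t, l). l \<in> {l1..l2} \<and> 0 \<le> t \<and> t \<le> \<theta> l - e}
           (\<lambda>n (t, l). picard n t l) (\<lambda>(t, l). sol t l) sequentially"
    (is "uniform_limit ?S _ _ _")
proof -
  have sub: "{l1..l2} \<subseteq> {0<..}" "{l1..l2} \<subseteq> {l. l > 0 \<and> \<theta> l > e}"
    using assms by auto
  obtain T where T: "T \<ge> 0" "\<And>l. l \<in> {l1..l2} \<Longrightarrow> \<bar>\<theta> l\<bar> \<le> T"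
    using continuous_on_interval_abs_bound[OF continuous_on_subset[OF theta_cont sub(1)]] by blast
  obtain K where K: "K \<ge> 0" "\<And>l. l \<in> {l1..l2} \<Longrightarrow> \<bar>L l e\<bar> \<le> K"
    using continuous_on_interval_abs_bound[OF continuous_on_subset[OF L_cont[OF assms(2)] sub(2)]]
    by blast
  have "continuous_on {l1..l2} (\<lambda>l. \<bar>u\<^sub>0 l\<bar> / (a * e) + C l)"
    using a_gt_1 assms(2) continuous_on_subset[OF u0_cont sub(1)]
      continuous_on_subset[OF C_cont sub(1)] by (intro continuous_intros) auto
  then obtain B where B: "B \<ge> 0" "\<And>l. l \<in> {l1..l2} \<Longrightarrow> \<bar>\<bar>u\<^sub>0 l\<bar> / (a * e) + C l\<bar> \<le> B"
    using continuous_on_interval_abs_bound by blast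
  let ?d = "\<lambda>n x. picard (Suc n) (fst x) (snd x) - picard n (fst x) (snd x)"
  define M where "M n = B * T * (inverse (fact n) * (K * T) ^ n)" for n
  have "norm (?d n x) \<le> M n" if "x \<in> ?S" for n x
  proof -
    obtain t l where x: "x = (t, l)" by (cases x)
    have l: "l \<in> {l1..l2}" and t: "0 \<le> t" "t \<le> \<theta> l - e" using that by (auto simp: x)
    have "l > 0" using l assms(1) by auto
    have "t \<le> T" using T(2)[OF l] t assms(2) by auto
    have "norm (?d n x) \<le> (\<bar>u\<^sub>0 l\<bar> / (a * e) + C l) * L l e ^ n * (t ^ Suc n / fact (Suc n))"
      unfolding x real_norm_def fst_conv snd_conv
      using assms l t \<open>l > 0\<close> by (intro picard_step_bound) auto
    also have "\<dots> \<le> B * K ^ n * (T ^ Suc n / fact n)"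
    proof (intro mult_mono frac_le power_mono)
      show "\<bar>u\<^sub>0 l\<bar> / (a * e) + C l \<le> B" "L l e \<le> K" using B(2)[OF l] K(2)[OF l] by auto
      show "0 \<le> L l e" using lipschitz_nonneg assms l \<open>l > 0\<close> by auto
      then show "0 \<le> L l e ^ n" by simp
      show "(fact n :: real) \<le> fact (Suc n)" by (intro fact_mono) auto
    qed (use B K T \<open>t \<le> T\<close> t in auto)
    also have "\<dots> = M n" by (simp add: M_def power_mult_distrib field_simps)
    finally show ?thesis .
  qed
  moreover have "summable M"
    unfolding M_def by (intro summable_mult summable_exp)
  ultimately have "uniform_limit ?S (\<lambda>n x. \<Sum>i<n. ?d i x) (\<lambda>x. suminf (\<lambda>i. ?d i x)) sequentially"
    by (intro Weierstrass_m_test) auto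
  then have "uniform_limit ?S (\<lambda>n x. picard 0 (fst x) (snd x) + (\<Sum>i<n. ?d i x))
      (\<lambda>x. picard 0 (fst x) (snd x) + suminf (\<lambda>i. ?d i x)) sequentially"
    by (intro uniform_limit_intros)
  moreover have "picard 0 (fst x) (snd x) + (\<Sum>i<n. ?d i x) = picard n (fst x) (snd x)" for n x
    by (subst sum_lessThan_telescope) simp
  ultimately have lim: "uniform_limit ?S (\<lambda>n x. picard n (fst x) (snd x))
      (\<lambda>x. picard 0 (fst x) (snd x) + suminf (\<lambda>i. ?d i x)) sequentially"
    by simp
  have sol_eq: "sol (fst x) (snd x) = picard 0 (fst x) (snd x) + suminf (\<lambda>i. ?d i x)" if "x \<in> ?S" for x
    using tendsto_uniform_limitI[OF lim that] unfolding sol_def by (rule limI)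
  have "uniform_limit ?S (\<lambda>n x. picard n (fst x) (snd x)) (\<lambda>x. sol (fst x) (snd x)) sequentially"
    by (rule uniform_limit_cong'[THEN iffD1, OF _ _ lim]) (simp_all only: sol_eq)
  then show ?thesis unfolding case_prod_unfold .
qed

text \<open>
  Every point of \<^const>\<open>region\<close> has a neighbourhood whose part in the region lies in one of the sets of
  uniform convergence.
\<close>

lemma continuous_on_sol: "continuous_on region (\<lambda>(t, l). sol t l)"
  unfolding continuous_on_eq_continuous_within
proof
  fix x assume x: "x \<in> region"
  then obtain t0 l0 where x_eq: "x = (t0, l0)" and l0: "l0 > 0" and t0: "0 \<le> t0" "t0 < \<theta> l0"
    by (auto simp: region_def)
  \<comment> \<open>The gap between \<open>t0\<close> and \<open>\<theta> l0\<close> is split in three: one part for the variation of the time, one for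
    that of \<open>\<theta> l\<close>, and one left as a margin between them.\<close>
  define e where "e = (\<theta> l0 - t0) / 3"
  have e: "e > 0" using t0 by (simp add: e_def)
  obtain d where d: "d > 0" "\<And>l. l > 0 \<Longrightarrow> \<bar>l - l0\<bar> < d \<Longrightarrow> \<bar>\<theta> l - \<theta> l0\<bar> < e"
    using theta_cont l0 e unfolding continuous_on_iff dist_real_def by (metis greaterThan_iff)
  define l1 where "l1 = l0 - min (d / 2) (l0 / 2)"
  define l2 where "l2 = l0 + min (d / 2) (l0 / 2)"
  have l12: "0 < l1" "l1 < l0" "l0 < l2" using d l0 by (auto simp: l1_def l2_def min_def field_simps)
  have near: "\<bar>\<theta> l - \<theta> l0\<bar> < e" if "l \<in> {l1..l2}" for l
    using that d l12 l0 by (intro d) (auto simp: l1_def l2_def)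
  let ?S = "{(t, l). l \<in> {l1..l2} \<and> 0 \<le> t \<and> t \<le> \<theta> l - e}"
  define U where "U = {..<t0 + e} \<times> {l1<..<l2}"
  have large: "2 * e < \<theta> l" if "l \<in> {l1..l2}" for l
  proof -
    have "3 * e = \<theta> l0 - t0" by (simp add: e_def)
    then show ?thesis using near[OF that] t0 by linarith
  qed
  then have lim: "uniform_limit ?S (\<lambda>n (t, l). picard n t l) (\<lambda>(t, l). sol t l) sequentially"
    using l12 e by (intro picard_uniform_limit) force+
  have "?S \<subseteq> region" using l12 e by (auto simp: region_def)
  have "continuous_on ?S (\<lambda>(t, l). sol t l)"
    by (rule uniform_limit_theorem[OF _ lim])
       (use continuous_on_subset[OF continuous_on_picard \<open>?S \<subseteq> region\<close>] in auto)
  moreover have "region \<inter> U \<subseteq> ?S"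
  proof
    fix y assume "y \<in> region \<inter> U"
    then obtain t l where y: "y = (t, l)" "0 \<le> t" "t < t0 + e" "l \<in> {l1..l2}"
      by (auto simp: region_def U_def)
    have "3 * e = \<theta> l0 - t0" by (simp add: e_def)
    then have "t \<le> \<theta> l - e" using near[OF y(4)] y(3) by linarith
    then show "y \<in> ?S" using y by auto
  qed
  ultimately have "continuous_on (region \<inter> U) (\<lambda>(t, l). sol t l)"
    by (rule continuous_on_subset)
  moreover have "x \<in> U" "open U"
    using e l12 by (auto simp: x_eq U_def intro: open_Times)
  ultimately have "continuous (at x within region \<inter> U) (\<lambda>(t, l). sol t l)"
    using x by (auto simp: continuous_on_eq_continuous_within)
  moreover have "at x within region \<inter> U = at x within region"
    by (rule at_within_nhd[OF \<open>x \<in> U\<close> \<open>open U\<close>]) auto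
  ultimately show "continuous (at x within region) (\<lambda>(t, l). sol t l)" by simp
qed

lemma sol_integral_equation:
  assumes "l > 0" "0 \<le> t" "t < \<theta> l"
  shows "sol t l = u\<^sub>0 l + integral {0..t} (\<lambda>s. g s (sol s l) l)"
proof -
  define e where "e = \<theta> l - t"
  define T where "T = {0..t}"
  have e: "0 < e" "e \<le> \<theta> l" using assms by (auto simp: e_def)
  have lim': "uniform_limit T (\<lambda>n s. picard n s l) (\<lambda>s. sol s l) sequentially"
  proof -
    have "uniform_limit {(t, m). m \<in> {l..l} \<and> 0 \<le> t \<and> t \<le> \<theta> m - e/2}
           (\<lambda>n (t, l). picard n t l) (\<lambda>(t, l). sol t l) sequentially"
      using assms e by (intro picard_uniform_limit) auto
    then have "uniform_limit T (\<lambda>n s. (\<lambda>(t, l). picard n t l) (s, l)) (\<lambda>s. (\<lambda>(t, l). sol t l) (s, l))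
       sequentially"
      by (rule uniform_limit_compose') (use e in \<open>auto simp: e_def T_def field_simps\<close>)
    then show ?thesis by simp
  qed
  have e2: "0 < e/2" "e/2 < \<theta> l" using e by auto
  have Lnn: "L l (e/2) \<ge> 0" using lipschitz_nonneg[OF assms(1) e2] .
  have "uniform_limit T (\<lambda>n s. g s (picard n s l) l) (\<lambda>s. g s (sol s l) l) sequentially"
  proof (rule uniform_limitI)
    fix \<epsilon> :: real assume "\<epsilon> > 0"
    define \<delta> where "\<delta> = \<epsilon> / (L l (e/2) + 1)"
    have "\<delta> > 0" using Lnn \<open>\<epsilon> > 0\<close> by (simp add: \<delta>_def)
    from uniform_limitD[OF lim' this]
    show "\<forall>\<^sub>F n in sequentially. \<forall>s\<in>T. dist (g s (picard n s l) l) (g s (sol s l) l) < \<epsilon>"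
    proof (rule eventually_mono, intro ballI)
      fix n s assume *: "\<forall>s\<in>T. dist (picard n s l) (sol s l) < \<delta>" and s: "s \<in> T"
      have "\<bar>g s (picard n s l) l - g s (sol s l) l\<bar> \<le> L l (e/2) * \<bar>picard n s l - sol s l\<bar>"
        using s e assms by (intro lipschitz) (auto simp: T_def e_def field_simps)
      also have "\<dots> \<le> L l (e/2) * \<delta>"
        using * s Lnn by (intro mult_left_mono) (auto simp: dist_real_def less_imp_le)
      also have "\<dots> < (L l (e/2) + 1) * \<delta>" using \<open>\<delta> > 0\<close> by (simp add: algebra_simps)
      also have "\<dots> = \<epsilon>" using Lnn by (simp add: \<delta>_def)
      finally show "dist (g s (picard n s l) l) (g s (sol s l) l) < \<epsilon>" by (simp add: dist_real_def)
    qed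
  qed
  moreover have "continuous_on {0..t} (\<lambda>s. g s (picard n s l) l)" for n
    using continuous_on_region_imp_slice[OF continuous_on_rhs_region[OF continuous_on_picard[of n]] assms(1)]
      assms(3) by (auto elim: continuous_on_subset)
  ultimately obtain I J where I: "\<And>n. ((\<lambda>s. g s (picard n s l) l) has_integral I n) {0..t}"
    and J: "((\<lambda>s. g s (sol s l) l) has_integral J) {0..t}" and IJ: "I \<longlonglongrightarrow> J"
    unfolding T_def by (rule uniform_limit_integral[where F = sequentially]) auto
  have "(\<lambda>n. u\<^sub>0 l + I n) \<longlonglongrightarrow> u\<^sub>0 l + J" using IJ by (intro tendsto_intros)
  moreover have "picard (Suc n) t l = u\<^sub>0 l + I n" for n using integral_unique[OF I] by simp
  ultimately have "(\<lambda>n. picard (Suc n) t l) \<longlonglongrightarrow> u\<^sub>0 l + J" by simp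
  moreover have "(\<lambda>n. picard (Suc n) t l) \<longlonglongrightarrow> sol t l"
    by (rule LIMSEQ_Suc, rule tendsto_uniform_limitI[OF lim']) (use assms in \<open>auto simp: T_def\<close>)
  ultimately have "sol t l = u\<^sub>0 l + J" using LIMSEQ_unique by blast
  then show ?thesis using integral_unique[OF J] by simp
qed

section \<open>The unique solution\<close>

text \<open>
  \<^const>\<open>ivp_solution\<close> for the real-valued right-hand side, without the requirement that \<open>w\<close> be
  undefined outside \<open>[0, \<theta> l)\<close>.
\<close>

definition solves :: "real \<Rightarrow> (real \<Rightarrow> real) \<Rightarrow> bool" where
  "solves l w \<longleftrightarrow> continuous_on {0..<\<theta> l} w \<and> w 0 = u\<^sub>0 l \<and>
     (\<forall>t\<in>{0..<\<theta> l}. (w has_real_derivative g t (w t) l) (at t within {0..<\<theta> l}))"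

lemma solves_DERIV:
  assumes "solves l w" "0 < t" "t < \<theta> l"
  shows "(w has_real_derivative g t (w t) l) (at t)"
proof -
  have "at t within {0..<\<theta> l} = at t" using assms by (intro at_within_interior) auto
  then show ?thesis using assms unfolding solves_def by (metis atLeastLessThan_iff less_imp_le)
qed

text \<open>
  Gronwall: with a Lipschitz constant \<open>K\<close> up to time \<open>t\<close>, the function
  \<open>s \<mapsto> (v s - w s)\<^sup>2 exp (- 2 K s)\<close> is nonincreasing, and it vanishes at \<open>0\<close>.
\<close>

lemma solves_unique:
  assumes l: "l > 0" and v: "solves l v" and w: "solves l w" and t: "0 \<le> t" "t < \<theta> l"
  shows "v t = w t"
proof (cases "t = 0")
  case True
  then show ?thesis using v w by (simp add: solves_def)
next
  case False
  define K where "K = L l (\<theta> l - t)"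
  let ?h = "\<lambda>s. (v s - w s)\<^sup>2 * exp (- 2 * K * s)"
  have "?h t \<le> ?h 0"
  proof (rule DERIV_nonpos_imp_decreasing_open[where f = ?h])
    show "0 \<le> t" by (rule t(1))
    have "continuous_on {0..t} v" "continuous_on {0..t} w"
      using v w t by (auto simp: solves_def elim!: continuous_on_subset)
    then show "continuous_on {0..t} ?h" by (intro continuous_intros)
    fix s assume s: "0 < s" "s < t"
    let ?d = "2 * (v s - w s) * (g s (v s) l - g s (w s) l) - 2 * K * (v s - w s)\<^sup>2"
    have "(v has_real_derivative g s (v s) l) (at s)" "(w has_real_derivative g s (w s) l) (at s)"
      using s t by (auto intro!: solves_DERIV v w)
    then have "(?h has_real_derivative ?d * exp (- 2 * K * s)) (at s)"
      by (auto intro!: derivative_eq_intros simp: algebra_simps power2_eq_square)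
    moreover have "?d \<le> 0"
    proof -
      have "(v s - w s) * (g s (v s) l - g s (w s) l)
          \<le> \<bar>v s - w s\<bar> * \<bar>g s (v s) l - g s (w s) l\<bar>" by (metis abs_ge_self abs_mult)
      also have "\<dots> \<le> \<bar>v s - w s\<bar> * (K * \<bar>v s - w s\<bar>)"
        unfolding K_def using s t l False by (intro mult_left_mono lipschitz) auto
      also have "\<dots> = K * (v s - w s)\<^sup>2" by (simp add: power2_eq_square abs_mult_self_eq mult_ac)
      finally have "2 * ((v s - w s) * (g s (v s) l - g s (w s) l)) \<le> 2 * (K * (v s - w s)\<^sup>2)"
        by simp
      then show ?thesis by (simp only: mult.assoc diff_le_0_iff_le)
    qed
    ultimately show "\<exists>y. (?h has_real_derivative y) (at s) \<and> y \<le> 0"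
      by (meson exp_ge_zero mult_nonpos_nonneg)
  qed
  moreover have "?h 0 = 0" using v w by (simp add: solves_def)
  ultimately have "(v t - w t)\<^sup>2 \<le> 0" by (simp add: mult_le_0_iff)
  then show ?thesis by simp
qed

lemma sol_solves:
  assumes l: "l > 0"
  shows "solves l (\<lambda>t. sol t l)"
  unfolding solves_def
proof (intro conjI ballI)
  show "continuous_on {0..<\<theta> l} (\<lambda>t. sol t l)"
    by (rule continuous_on_region_imp_slice[OF continuous_on_sol l])
  show "sol 0 l = u\<^sub>0 l" using sol_integral_equation[OF l, of 0] theta_pos[OF l] by simp
  fix t assume t: "t \<in> {0..<\<theta> l}"
  define T where "T = (t + \<theta> l) / 2"
  have T: "t < T" "T < \<theta> l" using t by (auto simp: T_def)
  let ?G = "\<lambda>s. g s (sol s l) l"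
  have "continuous_on {0..T} ?G"
    using continuous_on_region_imp_slice[OF continuous_on_rhs_region[OF continuous_on_sol] l] T
    by (auto elim: continuous_on_subset)
  then have "((\<lambda>t. u\<^sub>0 l + integral {0..t} ?G) has_real_derivative 0 + ?G t) (at t within {0..T})"
    using t T by (intro DERIV_add DERIV_const integral_has_real_derivative) auto
  moreover have "at t within {0..T} = at t within {0..<\<theta> l}"
    by (rule at_within_nhd[where S = "{..<T}"]) (use T in auto)
  ultimately have "((\<lambda>t. u\<^sub>0 l + integral {0..t} ?G) has_real_derivative ?G t) (at t within {0..<\<theta> l})"
    by simp
  then show "((\<lambda>t. sol t l) has_real_derivative ?G t) (at t within {0..<\<theta> l})"
    by (rule has_field_derivative_transform_within[where d = 1])
       (use t sol_integral_equation[OF l] in auto)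
qed

lemma the_ivp_solution_eq_sol:
  assumes l: "l > 0" and F: "\<And>t x. real_of_ereal (F t x) = g t x l"
  shows "the_ivp_solution F (\<theta> l) (u\<^sub>0 l) = restrict (\<lambda>t. sol t l) {0..<\<theta> l}"
proof -
  have char: "ivp_solution F (\<theta> l) (u\<^sub>0 l) w \<longleftrightarrow> w \<in> extensional {0..<\<theta> l} \<and> solves l w" for w
    unfolding ivp_solution_def solves_def F by (rule refl)
  let ?w = "restrict (\<lambda>t. sol t l) {0..<\<theta> l}"
  have "solves l ?w"
    unfolding solves_def
  proof (intro conjI ballI)
    show "continuous_on {0..<\<theta> l} ?w"
      using sol_solves[OF l] unfolding solves_def by (subst continuous_on_cong[OF refl]) auto
    show "?w 0 = u\<^sub>0 l" using sol_solves[OF l] theta_pos[OF l] by (simp add: solves_def)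
    fix t assume t: "t \<in> {0..<\<theta> l}"
    then have "((\<lambda>t. sol t l) has_real_derivative g t (sol t l) l) (at t within {0..<\<theta> l})"
      using sol_solves[OF l] by (auto simp: solves_def)
    then show "(?w has_real_derivative g t (?w t) l) (at t within {0..<\<theta> l})"
      using t by (auto intro: has_field_derivative_transform_within[where d = 1])
  qed
  then show ?thesis
    unfolding the_ivp_solution_def char
  proof (intro the_equality conjI)
    fix w assume w: "w \<in> extensional {0..<\<theta> l} \<and> solves l w"
    show "w = ?w"
      by (rule extensionalityI[of _ "{0..<\<theta> l}"])
         (use w solves_unique[OF l _ sol_solves[OF l], of w] in auto)
  qed auto
qed

section \<open>Growth near the end of the time interval\<close>

text \<open>The factor \<open>M(\<lambda>)\<close> in the bound \<open>|u\<^sub>\<lambda>(t)| \<le> M(\<lambda>) (\<theta>(\<lambda>) - t)\<^bsup>-1/a\<^esup>\<close>.\<close>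

definition envelope :: "real \<Rightarrow> real" where
  "envelope l = sqrt ((u\<^sub>0 l)\<^sup>2 + 1) * \<theta> l powr (1 / a) + C l * \<theta> l powr (1 / a) * \<theta> l"

text \<open>
  The function \<open>w = sqrt (u\<^sup>2 + 1)\<close> is a differentiable substitute for \<open>|u|\<close> with \<open>|u| \<le> w\<close> and
  \<open>w' \<le> |u'| \<le> w / (a (\<theta> - t)) + C\<close>. The integrating factor \<open>(\<theta> - t)\<^bsup>1/a\<^esup>\<close> then makes
  \<open>w (\<theta> - t)\<^bsup>1/a\<^esup> - C \<theta>\<^bsup>1/a\<^esup> t\<close> nonincreasing.
\<close>

lemma sol_bound:
  assumes l: "l > 0" and t: "0 \<le> t" "t < \<theta> l"
  shows "\<bar>sol t l\<bar> \<le> envelope l * (\<theta> l - t) powr - (1 / a)"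
proof -
  define b where "b = 1 / a"
  have b: "0 < b" "b < 1" using a_gt_1 by (auto simp: b_def)
  let ?w = "\<lambda>s. sqrt ((sol s l)\<^sup>2 + 1)"
  let ?z = "\<lambda>s. ?w s * (\<theta> l - s) powr b - C l * \<theta> l powr b * s"
  have abs_le: "\<bar>sol s l\<bar> \<le> ?w s" for s by (simp add: real_le_rsqrt)
  have "?z t \<le> ?z 0"
  proof (rule DERIV_nonpos_imp_decreasing_open[where f = ?z])
    show "0 \<le> t" by fact
    have "continuous_on {0..t} (\<lambda>s. sol s l)"
      using sol_solves[OF l] t by (auto simp: solves_def elim!: continuous_on_subset)
    then show "continuous_on {0..t} ?z" using t by (intro continuous_intros) auto
    fix s assume s: "0 < s" "s < t"
    let ?u = "sol s l" and ?g = "g s (sol s l) l" and ?r = "\<theta> l - s"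
    let ?d = "(?u * ?g / ?w s) * ?r powr b - ?w s * (b * ?r powr (b - 1)) - C l * \<theta> l powr b"
    have r: "?r > 0" using s t by simp
    have w: "?w s > 0" by (simp add: add_nonneg_pos)
    have "((\<lambda>s. sol s l) has_real_derivative ?g) (at s)"
      using s t by (intro solves_DERIV sol_solves l) auto
    moreover have "(sol s l)\<^sup>2 + 1 > 0" by (simp add: add_nonneg_pos)
    ultimately have "(?w has_real_derivative ?u * ?g / ?w s) (at s)"
      by (auto intro!: derivative_eq_intros simp: divide_simps)
    from DERIV_mult[OF this DERIV_powr_distance[of s "\<theta> l" b]]
    have "((\<lambda>s. ?w s * (\<theta> l - s) powr b) has_real_derivative
        ?u * ?g / ?w s * ?r powr b + (- b * ?r powr (b - 1)) * ?w s) (at s)"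
      using r by simp
    from DERIV_diff[OF this DERIV_cmult[OF DERIV_ident, of "C l * \<theta> l powr b"]]
    have "(?z has_real_derivative ?d) (at s)"
      by (rule DERIV_cong) simp
    moreover have "?d \<le> 0"
    proof -
      have "?u * ?g / ?w s \<le> \<bar>?u\<bar> * \<bar>?g\<bar> / ?w s"
        using w by (intro divide_right_mono) (auto simp: abs_mult[symmetric])
      also have "\<dots> \<le> ?w s * \<bar>?g\<bar> / ?w s"
        using w abs_le by (intro divide_right_mono mult_right_mono) auto
      also have "\<dots> = \<bar>?g\<bar>" using w by simp
      also have "\<dots> \<le> \<bar>?u\<bar> / (a * ?r) + C l" using s t l by (intro growth) auto
      also have "\<dots> \<le> ?w s / (a * ?r) + C l"
        using r a_gt_1 abs_le by (intro add_mono divide_right_mono) auto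
      finally have "?u * ?g / ?w s * ?r powr b \<le> (?w s / (a * ?r) + C l) * ?r powr b"
        by (intro mult_right_mono) auto
      also have "\<dots> = ?w s * (b * ?r powr (b - 1)) + C l * ?r powr b"
      proof -
        have "?r powr b = ?r * ?r powr (b - 1)" using r by (simp add: powr_mult_base)
        then have "?w s / (a * ?r) * ?r powr b = ?w s * (b * ?r powr (b - 1))"
          using r by (simp add: b_def)
        then show ?thesis by (simp only: distrib_right)
      qed
      also have "\<dots> \<le> ?w s * (b * ?r powr (b - 1)) + C l * \<theta> l powr b"
        using r s b C_nonneg[OF l] by (intro add_left_mono mult_left_mono powr_mono2) auto
      finally show ?thesis by simp
    qed
    ultimately show "\<exists>y. (?z has_real_derivative y) (at s) \<and> y \<le> 0" by blast
  qed
  then have "?w t * (\<theta> l - t) powr b \<le> ?w 0 * \<theta> l powr b + C l * \<theta> l powr b * t" by simp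
  also have "\<dots> \<le> envelope l"
  proof -
    have "sol 0 l = u\<^sub>0 l" using sol_solves[OF l] by (simp add: solves_def)
    then show ?thesis
      using t C_nonneg[OF l] by (auto simp: envelope_def b_def intro!: mult_left_mono)
  qed
  finally have "?w t \<le> envelope l * (\<theta> l - t) powr - b"
    using t by (simp add: powr_minus field_simps)
  then show ?thesis using abs_le[of t] by (simp add: b_def)
qed

lemma envelope_nonneg: "l > 0 \<Longrightarrow> envelope l \<ge> 0"
  using theta_pos C_nonneg by (auto simp: envelope_def less_imp_le)

text \<open>The integral of the majorant in \<open>sol_bound\<close> over \<open>[t, \<theta> l)\<close>.\<close>

definition tail_bound :: "real \<Rightarrow> real \<Rightarrow> real" where
  "tail_bound l t = envelope l / (1 - 1 / a) * (\<theta> l - t) powr (1 - 1 / a)"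

text \<open>
  Instead of integrating the bound on \<^const>\<open>sol\<close>, the proof uses that the primitive \<open>G\<close> of the
  solution makes both \<open>G + tail_bound l\<close> and \<open>- G + tail_bound l\<close> nonincreasing.
\<close>

lemma integral_sol_tail:
  assumes l: "l > 0" and s: "0 \<le> s" and st: "s \<le> t" and t: "t < \<theta> l"
  shows "\<bar>integral {0..t} (\<lambda>s. sol s l) - integral {0..s} (\<lambda>s. sol s l)\<bar> \<le> tail_bound l s"
proof -
  define b where "b = 1 / a"
  have b: "0 < b" "b < 1" using a_gt_1 by (auto simp: b_def)
  let ?G = "\<lambda>t. integral {0..t} (\<lambda>s. sol s l)"
  let ?N = "envelope l / (1 - b)"
  have cont: "continuous_on {0..t} (\<lambda>s. sol s l)"
    using sol_solves[OF l] t by (auto simp: solves_def elim!: continuous_on_subset)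
  \<comment> \<open>The sign \<open>\<sigma>\<close> yields both halves of the absolute value bound.\<close>
  have main: "\<sigma> * ?G t + ?N * (\<theta> l - t) powr (1 - b) \<le> \<sigma> * ?G s + ?N * (\<theta> l - s) powr (1 - b)"
    if \<sigma>: "\<bar>\<sigma>\<bar> = 1" for \<sigma> :: real
  proof (rule DERIV_nonpos_imp_decreasing_open[OF st,
      where f = "\<lambda>t. \<sigma> * ?G t + ?N * (\<theta> l - t) powr (1 - b)"])
    have "continuous_on {0..t} ?G"
      by (rule indefinite_integral_continuous_1) (rule integrable_continuous_interval[OF cont])
    then have "continuous_on {s..t} ?G" using s by (auto elim!: continuous_on_subset)
    then show "continuous_on {s..t} (\<lambda>t. \<sigma> * ?G t + ?N * (\<theta> l - t) powr (1 - b))"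
      using t b by (intro continuous_intros) auto
    fix x assume x: "s < x" "x < t"
    have "(?G has_real_derivative sol x l) (at x within {0..t})"
      using x s by (intro integral_has_real_derivative cont) auto
    moreover have "at x within {0..t} = at x" using x s by (intro at_within_interior) auto
    ultimately have "(?G has_real_derivative sol x l) (at x)" by simp
    moreover have "((\<lambda>s. (\<theta> l - s) powr (1 - b)) has_real_derivative
        - (1 - b) * (\<theta> l - x) powr (1 - b - 1)) (at x)"
      using x t by (intro DERIV_powr_distance) auto
    ultimately have "((\<lambda>t. \<sigma> * ?G t + ?N * (\<theta> l - t) powr (1 - b)) has_real_derivative
        \<sigma> * sol x l + ?N * (- (1 - b) * (\<theta> l - x) powr (1 - b - 1))) (at x)"
      by (intro DERIV_add DERIV_cmult)
    moreover have "?N * (- (1 - b) * (\<theta> l - x) powr (1 - b - 1)) = - (envelope l * (\<theta> l - x) powr - b)"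
      using b by (simp add: divide_simps) (simp add: algebra_simps)
    moreover have "\<sigma> * sol x l \<le> \<bar>sol x l\<bar>" by (metis \<sigma> abs_ge_self abs_mult mult_1)
    moreover have "\<bar>sol x l\<bar> \<le> envelope l * (\<theta> l - x) powr - b"
      unfolding b_def using sol_bound[OF l] x s t by simp
    ultimately show "\<exists>y. ((\<lambda>t. \<sigma> * ?G t + ?N * (\<theta> l - t) powr (1 - b)) has_real_derivative y) (at x)
        \<and> y \<le> 0" by force
  qed
  have "0 \<le> ?N * (\<theta> l - t) powr (1 - b)" using envelope_nonneg[OF l] b by simp
  then show ?thesis using main[of 1] main[of "-1"] unfolding tail_bound_def b_def by auto
qed

lemma tail_bound_tendsto_0: "(tail_bound l \<longlongrightarrow> 0) (at_left (\<theta> l))"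
proof -
  have e: "0 < 1 - 1 / a" using a_gt_1 by simp
  have "((\<lambda>t. (\<theta> l - t) powr (1 - 1 / a)) \<longlongrightarrow> 0 powr (1 - 1 / a)) (at_left (\<theta> l))"
  proof (rule tendsto_powr'[where b = "1 - 1 / a"])
    show "((\<lambda>t. \<theta> l - t) \<longlongrightarrow> 0) (at_left (\<theta> l))"
      by (rule tendsto_eq_intros refl)+ simp
    show "0 \<noteq> (0::real) \<or> 0 < 1 - 1 / a \<and> (\<forall>\<^sub>F t in at_left (\<theta> l). 0 \<le> \<theta> l - t)"
      using e by (auto simp: eventually_at_left_field intro!: exI[of _ "\<theta> l - 1"])
  qed (rule tendsto_const)
  then show ?thesis
    unfolding tail_bound_def using e by (intro tendsto_mult_right_zero) auto
qed

section \<open>Continuity of the total integral\<close>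

text \<open>The value \<open>\<phi>(l)\<close>, as a limit of proper integrals of \<^const>\<open>sol\<close>.\<close>

definition total_integral :: "real \<Rightarrow> real" where
  "total_integral l = Lim (at_left (\<theta> l)) (\<lambda>t. integral {0..t} (\<lambda>s. sol s l))"

lemma total_integral:
  assumes l: "l > 0"
  shows "((\<lambda>t. integral {0..t} (\<lambda>s. sol s l)) \<longlongrightarrow> total_integral l) (at_left (\<theta> l))"
    and "\<And>s. 0 \<le> s \<Longrightarrow> s < \<theta> l \<Longrightarrow>
      \<bar>total_integral l - integral {0..s} (\<lambda>s. sol s l)\<bar> \<le> tail_bound l s"
proof -
  obtain I where I: "((\<lambda>t. integral {0..t} (\<lambda>s. sol s l)) \<longlongrightarrow> I) (at_left (\<theta> l))"
    "\<And>s. 0 \<le> s \<Longrightarrow> s < \<theta> l \<Longrightarrow> \<bar>I - integral {0..s} (\<lambda>s. sol s l)\<bar> \<le> tail_bound l s"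
    using tail_bound_imp_limit_at_left[OF theta_pos[OF l] integral_sol_tail[OF l] tail_bound_tendsto_0]
    by blast
  have "total_integral l = I" unfolding total_integral_def by (intro tendsto_Lim I) simp
  then show "((\<lambda>t. integral {0..t} (\<lambda>s. sol s l)) \<longlongrightarrow> total_integral l) (at_left (\<theta> l))"
    and "\<And>s. 0 \<le> s \<Longrightarrow> s < \<theta> l \<Longrightarrow>
      \<bar>total_integral l - integral {0..s} (\<lambda>s. sol s l)\<bar> \<le> tail_bound l s"
    using I by auto
qed

lemma continuous_on_total_integral:
  assumes "0 < l1"
  shows "continuous_on {l1..l2} total_integral"
proof -
  have sub: "{l1..l2} \<subseteq> {0<..}" using assms by auto
  have theta: "continuous_on {l1..l2} \<theta>" by (rule continuous_on_subset[OF theta_cont sub])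
  define e where "e = 1 - 1 / a"
  have e: "e > 0" using a_gt_1 by (simp add: e_def)
  \<comment> \<open>Truncation at a fixed fraction of \<open>\<theta> l\<close> keeps the truncation time continuous in \<open>l\<close>.\<close>
  define x where "x n l = \<theta> l * (1 - inverse (real (Suc n)))" for n l
  have x_range: "0 \<le> x n l" "x n l < \<theta> l" if "l \<in> {l1..l2}" for n l
    using theta_pos[of l] that assms
    by (auto simp: x_def field_simps)
  define F where "F n l = integral {0..x n l} (\<lambda>s. sol s l)" for n l
  have F_cont: "continuous_on {l1..l2} (F n)" for n
  proof -
    have "continuous_on {l1..l2} (\<lambda>l. (\<lambda>(t, l). integral {0..t} (\<lambda>s. sol s l)) (x n l, l))"
    proof (rule continuous_on_compose2[OF continuous_on_region_primitive[OF continuous_on_sol]])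
      show "continuous_on {l1..l2} (\<lambda>l. (x n l, l))"
        unfolding x_def by (intro continuous_intros theta)
      show "(\<lambda>l. (x n l, l)) ` {l1..l2} \<subseteq> region"
        using x_range sub by (auto simp: region_def)
    qed
    then show ?thesis by (simp add: F_def[abs_def])
  qed
  have "continuous_on {l1..l2} (\<lambda>l. envelope l / e * \<theta> l powr e)"
    unfolding envelope_def
    using theta continuous_on_subset[OF u0_cont sub] continuous_on_subset[OF C_cont sub]
      theta_pos sub e by (intro continuous_intros) (auto simp: less_imp_neq[symmetric] subset_iff)
  then obtain K where K: "K \<ge> 0" "\<And>l. l \<in> {l1..l2} \<Longrightarrow> \<bar>envelope l / e * \<theta> l powr e\<bar> \<le> K"
    using continuous_on_interval_abs_bound by blast
  have tail_le: "tail_bound l (x n l) \<le> K * inverse (real (Suc n)) powr e" if "l \<in> {l1..l2}" for n l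
  proof -
    have "\<theta> l > 0" using that assms theta_pos by auto
    have "\<theta> l - x n l = \<theta> l * inverse (real (Suc n))" by (simp add: x_def algebra_simps)
    then have "tail_bound l (x n l) = (envelope l / e * \<theta> l powr e) * inverse (real (Suc n)) powr e"
      unfolding tail_bound_def e_def[symmetric] using \<open>\<theta> l > 0\<close> by (simp add: powr_mult)
    also have "\<dots> \<le> K * inverse (real (Suc n)) powr e"
      using abs_le_D1[OF K(2)[OF that]] by (intro mult_right_mono) simp_all
    finally show ?thesis .
  qed
  have lim0: "(\<lambda>n. K * inverse (real (Suc n)) powr e) \<longlonglongrightarrow> 0"
  proof -
    have "(\<lambda>n. inverse (real (Suc n)) powr e) \<longlonglongrightarrow> 0 powr e"
      using e by (intro tendsto_powr' LIMSEQ_inverse_real_of_nat tendsto_const) auto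
    then show ?thesis using tendsto_mult_right_zero by auto
  qed
  have "uniform_limit {l1..l2} F total_integral sequentially"
  proof (rule uniform_limitI)
    fix \<epsilon> :: real assume "\<epsilon> > 0"
    then have "\<forall>\<^sub>F n in sequentially. K * inverse (real (Suc n)) powr e < \<epsilon>"
      using order_tendstoD(2)[OF lim0] by blast
    then show "\<forall>\<^sub>F n in sequentially. \<forall>l\<in>{l1..l2}. dist (F n l) (total_integral l) < \<epsilon>"
    proof (rule eventually_mono, intro ballI)
      fix n l assume *: "K * inverse (real (Suc n)) powr e < \<epsilon>" "l \<in> {l1..l2}"
      then have "l > 0" using assms by auto
      show "dist (F n l) (total_integral l) < \<epsilon>"
        using total_integral(2)[OF \<open>l > 0\<close> x_range[OF *(2), of n]] tail_le[OF *(2), of n] *(1)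
        unfolding F_def dist_real_def by linarith
    qed
  qed
  then show ?thesis
    by (rule uniform_limit_theorem[rotated]) (use F_cont in auto)
qed

lemma has_improper_integral_solution:
  assumes l: "l > 0"
  shows "has_improper_integral (restrict (\<lambda>t. sol t l) {0..<\<theta> l}) (\<theta> l) (total_integral l)"
  unfolding has_improper_integral_def
proof (intro conjI ballI)
  let ?w = "restrict (\<lambda>t. sol t l) {0..<\<theta> l}"
  fix t assume t: "t \<in> {0..<\<theta> l}"
  then have "(\<lambda>s. sol s l) integrable_on {0..t}"
    using sol_solves[OF l] unfolding solves_def
    by (intro integrable_continuous_interval) (auto elim!: continuous_on_subset)
  then show "?w integrable_on {0..t}"
    by (rule integrable_eq) (use t in auto)
next
  let ?w = "restrict (\<lambda>t. sol t l) {0..<\<theta> l}"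
  have "\<forall>\<^sub>F t in at_left (\<theta> l). integral {0..t} (\<lambda>s. sol s l) = integral {0..t} ?w"
    using eventually_at_left_real[OF theta_pos[OF l]]
    by eventually_elim (auto intro!: integral_cong)
  then show "((\<lambda>t. integral {0..t} ?w) \<longlongrightarrow> total_integral l) (at_left (\<theta> l))"
    by (rule Lim_transform_eventually[OF total_integral(1)[OF l]])
qed

end

section \<open>Attaining the prescribed value\<close>

theorem theorem2p6:
  fixes \<theta> u\<^sub>0 C :: "real \<Rightarrow> real"
    and f :: "real \<Rightarrow> real \<Rightarrow> real \<Rightarrow> ereal"
    and L :: "real \<Rightarrow> real \<Rightarrow> real"
    and u :: "real \<Rightarrow> real \<Rightarrow> real"
    and \<phi> :: "real \<Rightarrow> real"
    and a p lo hi :: real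
  assumes theta_pos: "\<And>l. l > 0 \<Longrightarrow> \<theta> l > 0"
    and f_finite: "\<And>t x l. l > 0 \<Longrightarrow> t \<in> {0..<\<theta> l} \<Longrightarrow> \<bar>f t x l\<bar> \<noteq> \<infinity>"
    and f_blowup: "\<And>l. l > 0 \<Longrightarrow>
      (AE x in lebesgue. ((\<lambda>t. f t x l) \<longlongrightarrow> \<infinity>) (at_left (\<theta> l)) \<or>
                         ((\<lambda>t. f t x l) \<longlongrightarrow> -\<infinity>) (at_left (\<theta> l)))"
    and f_lipschitz: "\<And>l e t x y. l > 0 \<Longrightarrow> 0 < e \<Longrightarrow> e < \<theta> l \<Longrightarrow> t \<in> {0..\<theta> l - e} \<Longrightarrow>
      \<bar>f t x l - f t y l\<bar> \<le> ereal (L l e * \<bar>x - y\<bar>)"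
    and theta_cont: "continuous_on {0<..} \<theta>"
    and u0_cont: "continuous_on {0<..} u\<^sub>0"
    and L_cont: "\<And>e. e > 0 \<Longrightarrow> continuous_on {l. l > 0 \<and> \<theta> l > e} (\<lambda>l. L l e)"
    and f_cont: "continuous_on {(t, x, l). l > 0 \<and> t \<in> {0..<\<theta> l}} (\<lambda>(t, x, l). f t x l)"
    and a_gt_1: "a > 1"
    and f_growth: "\<And>l t x. l > 0 \<Longrightarrow> t \<in> {0..<\<theta> l} \<Longrightarrow>
      \<bar>f t x l\<bar> \<le> ereal (\<bar>x\<bar> / (a * (\<theta> l - t)) + C l)"
    and C_nonneg: "\<And>l. l > 0 \<Longrightarrow> C l \<ge> 0"
    and C_cont: "continuous_on {0<..} C"
    and u_def: "\<And>l. l > 0 \<Longrightarrow> u l = the_ivp_solution (\<lambda>t x. f t x l) (\<theta> l) (u\<^sub>0 l)"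
    and phi_def: "\<And>l. l > 0 \<Longrightarrow> \<phi> l = improper_integral (u l) (\<theta> l)"
    and lo_pos: "lo > 0" and hi_pos: "hi > 0"
    and phi_lo: "\<phi> lo < p" and phi_hi: "\<phi> hi > p"
  shows "\<exists>l\<in>{min lo hi<..<max lo hi}. has_improper_integral (u l) (\<theta> l) p"
proof -
  define g where "g t x l = real_of_ereal (f t x l)" for t x l
  have f_eq: "f t x l = ereal (g t x l)" if "l > 0" "t \<in> {0..<\<theta> l}" for t x l
    using f_finite[OF that, of x] unfolding g_def by (simp add: ereal_real')
  interpret ivp_family \<theta> u\<^sub>0 C g L a
  proof
    fix l e t x y :: real
    assume l: "l > 0" and e: "0 < e" "e < \<theta> l" "t \<in> {0..\<theta> l - e}"
    then have "t \<in> {0..<\<theta> l}" by auto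
    with f_lipschitz[OF l e, of x y] show "\<bar>g t x l - g t y l\<bar> \<le> L l e * \<bar>x - y\<bar>"
      by (simp add: f_eq l)
  next
    fix l t x :: real
    assume l: "l > 0" and t: "t \<in> {0..<\<theta> l}"
    then show "\<bar>g t x l\<bar> \<le> \<bar>x\<bar> / (a * (\<theta> l - t)) + C l"
      using f_growth[OF l t, of x] by (simp add: f_eq)
  next
    let ?D = "{(t, x, l). l > 0 \<and> t \<in> {0..<\<theta> l}}"
    have "continuous_on ?D (real_of_ereal \<circ> (\<lambda>(t, x, l). f t x l))"
    proof (subst continuous_on_iff_real[symmetric])
      fix z :: "real \<times> real \<times> real" assume "z \<in> ?D"
      obtain t x l where z: "z = (t, x, l)" by (cases z)
      have "l > 0" "t \<in> {0..<\<theta> l}" using \<open>z \<in> ?D\<close> by (auto simp: z)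
      then show "\<bar>(\<lambda>(t, x, l). f t x l) z\<bar> \<noteq> \<infinity>" using f_finite[of l t x] unfolding z by simp
    qed (rule f_cont)
    then show "continuous_on ?D (\<lambda>(t, x, l). g t x l)"
      by (simp add: g_def o_def case_prod_beta)
  qed (use theta_pos theta_cont u0_cont L_cont a_gt_1 C_nonneg C_cont in auto)
  have u_improper: "has_improper_integral (u l) (\<theta> l) (total_integral l)" if "l > 0" for l
    using has_improper_integral_solution[OF that]
      the_ivp_solution_eq_sol[OF that, of "\<lambda>t x. f t x l"] u_def[OF that] by (simp add: g_def)
  have phi: "\<phi> l = total_integral l" if "l > 0" for l
    using improper_integral_eq[OF u_improper[OF that]] phi_def[OF that] by simp
  have "continuous_on {min lo hi..max lo hi} total_integral"
    using lo_pos hi_pos by (intro continuous_on_total_integral) auto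
  then obtain l where l: "l \<in> {min lo hi<..<max lo hi}" "total_integral l = p"
    using phi_lo phi_hi phi[OF lo_pos] phi[OF hi_pos] by (auto elim: IVT_strict_between)
  then have "l > 0" using lo_pos hi_pos by auto
  then show ?thesis using u_improper[of l] l by auto
qed

end
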